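(* For every $k=1,\dots,t$ and every $j$ with $0\le j<\deg P^{(k)}_2$, $$\bar S_{k,j}(F,G)=(R'_{k-1})^{b_{k,j}}\,r_{k,j}\,\tilde S_{k,j}(F,G).$$
   Context: Let $K$ be a field of characteristic zero; $|M|$ denotes the determinant of a square matrix $M$; $\mathrm{lc}$ and $\deg$ denote leading coefficient and degree. Subresultant matrices. Let $A=a_px^p+\dots+a_0$, $B=b_qx^q+\dots+b_0$ over $K$ regarded with formal degrees $p\ge q>0$. For $0\le j<q$, $N^{(j)}(A,B)$ is the $(p+q-j)\times(p+q-2j)$ matrix whose $c$-th column ($c=1,\dots,q-j$) has $a_p,\dots,a_0$ in rows $c,\dots,c+p$ and zeros elsewhere, and whose $(q-j+c)$-th column ($c=1,\dots,p-j$) has $b_q,\dots,b_0$ in rows $c,\dots,c+q$ and zeros elsewhere. PRS. For nonzero $A,B\in K[x]$, $\deg A>\deg B$, a PRS is $(P_1,\dots,P_l)$, nonzero polynomials, $P_1=A$, $P_2=B$, $\deg P_{i-1}>\deg P_i$, $\alpha_iP_{i-2}=q_{i-1}P_{i-1}+\beta_iP_i$ ($i=3,\dots,l$) with $\alpha_i,\beta_i\in K\setminus\{0\}$, $q_{i-1}\in K[x]$, and $P_l=\gamma\gcd(A,B)$, $0\ne\gamma\in K$. Recursive PRS. $F=f_mx^m+\dots+f_0$, $G=g_nx^n+\dots+g_0\in K[x]$, $f_mg_n\ne0$, $m>n>0$. A complete recursive PRS consists of PRSs $(P^{(k)}_1,\dots,P^{(k)}_{l_k})$, $k=1,\dots,t$,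 $P^{(1)}_1=F$, $P^{(1)}_2=G$, for $k\ge2$ $P^{(k)}_1=P^{(k-1)}_{l_{k-1}}$, $P^{(k)}_2=\frac d{dx}P^{(k)}_1$; $P^{(k)}_{l_k}$ non-constant for $k<t$, $P^{(t)}_{l_t}$ constant. Assume $l_k\ge3$ for $k<t$. Notation: $n^{(k)}_i=\deg P^{(k)}_i$, $j_0=m$, $j_k=n^{(k)}_{l_k}$. Recursive subresultants ($0\le j<n^{(k)}_2$): $\bar N^{(1,j)}=N^{(j)}(F,G)$; for $k\ge2$, with $\bar N=\bar N^{(k-1,j_{k-1})}$ having $C$ columns, $\bar N_U$ = $\bar N$ minus its bottom $j_{k-1}+1$ rows, $\bar N_L$ = its bottom $j_{k-1}+1$ rows, $\bar N'_L$ = the $j_{k-1}\times C$ matrix whose $i$-th row is $(j_{k-1}+1-i)$ times row $i$ of $\bar N_L$, and $b=2j_{k-1}-2j-1$, $e=j_{k-1}-j-1$: $\bar N^{(k,j)}$ has $bC$ columns in $b$ blocks of width $C$, upper part $\mathrm{diag}(\bar N_U,\dots,\bar N_U)$ ($b$ copies), and a lower part of $2j_{k-1}-j-1$ rows in which column block $s$ ($s=1,\dots,e$) holds $\bar N_L$ in lower rows $s,\dots,s+j_{k-1}$ and column block $e+s$ ($s=1,\dots,j_{k-1}-j$) holds $\bar N'_L$ in lower rows $s,\dots,s+j_{k-1}-1$; other entries $0$. If $\bar N^{(k,j)}$ has $D$ columns, $\bar N^{(k,j)}_\tau$ ($\tau=0,\dots,j$) is formed by its top $D-1$ rows and its $(D+j-\tau)$-th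 row, and $\bar S_{k,j}(F,G)=\sum_{\tau=0}^j|\bar N^{(k,j)}_\tau|x^\tau$. Nested subresultants ($0\le j<n^{(k)}_2$): $\tilde N^{(1,j)}=N^{(j)}(F,G)$; for $k\ge2$, $\tilde N^{(k,j)}=N^{(j)}\big(\tilde S_{k-1,j_{k-1}}(F,G),\frac d{dx}\tilde S_{k-1,j_{k-1}}(F,G)\big)$ with formal degrees $j_{k-1}$ and $j_{k-1}-1$. $\tilde N^{(k,j)}_\tau$ is formed by the top $n^{(k)}_1+n^{(k)}_2-2j-1$ rows and the $(n^{(k)}_1+n^{(k)}_2-j-\tau)$-th row of $\tilde N^{(k,j)}$, and $\tilde S_{k,j}(F,G)=\sum_{\tau=0}^j|\tilde N^{(k,j)}_\tau|x^\tau$. Constants. For $k\ge2$: $b_{k,j}=2j_{k-1}-2j-1$, $u_{k,j}=(m+n-2j_1)\{\prod_{l=2}^{k-1}(2j_{l-1}-2j_l-1)\}b_{k,j}$, $r_{k,j}=(-1)^{(u_{k-1}-1)(1+2+\dots+(b_{k,j}-1))}$; $b_{1,j}=r_{1,j}=1$, $u_1=m+n-2j_1$; $b_k=b_{k,j_k}$, $u_k=u_{k,j_k}$, $r_k=r_{k,j_k}$. $R'_0=1$ and $R'_k=(R'_{k-1})^{b_k}r_k$ for $k=1,\dots,t-1$ (so $R'_1=1$). *)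

theory Defs
  imports "Jordan_Normal_Form.Determinant" "HOL-Computational_Algebra.Polynomial"
begin

text \<open>All row/column indices below are 0-based (Jordan_Normal_Form convention);
  the paper uses 1-based indices.\<close>

definition subres_mat :: "nat \<Rightarrow> nat \<Rightarrow> 'a::zero poly \<Rightarrow> 'a poly \<Rightarrow> nat \<Rightarrow> 'a mat" where
  "subres_mat p q A B j = mat (p + q - j) (p + q - 2 * j) (\<lambda>(r, c).
     if c < q - j then
       (if c \<le> r \<and> r \<le> c + p then coeff A (p - (r - c)) else 0)
     else (let c' = c - (q - j) in
       (if c' \<le> r \<and> r \<le> c' + q then coeff B (q - (r - c')) else 0)))"

definition subres_poly :: "'a::comm_ring_1 mat \<Rightarrow> nat \<Rightarrow> 'a poly" where
  "subres_poly M j = (\<Sum>\<tau>\<le>j. monom (det (mat (dim_col M) (dim_col M) (\<lambda>(r, c).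
       if r < dim_col M - 1 then M $$ (r, c) else M $$ (dim_col M + j - \<tau> - 1, c)))) \<tau>)"

text \<open>The last condition says that the last element is a greatest common divisor of A and B,
  i.e. (being nonzero) equals gamma * gcd(A,B) for some nonzero constant gamma.\<close>

definition is_prs :: "'a::field_char_0 poly \<Rightarrow> 'a poly \<Rightarrow> 'a poly list \<Rightarrow> bool" where
  "is_prs A B Ps \<longleftrightarrow>
     length Ps \<ge> 2 \<and> Ps ! 0 = A \<and> Ps ! 1 = B \<and>
     (\<forall>i < length Ps. Ps ! i \<noteq> 0) \<and>
     (\<forall>i. 0 < i \<and> i < length Ps \<longrightarrow> degree (Ps ! (i - 1)) > degree (Ps ! i)) \<and>
     (\<forall>i. 2 \<le> i \<and> i < length Ps \<longrightarrow>
        (\<exists>\<alpha> \<beta> q. \<alpha> \<noteq> 0 \<and> \<beta> \<noteq> 0 \<and>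
           smult \<alpha> (Ps ! (i - 2)) = q * Ps ! (i - 1) + smult \<beta> (Ps ! i))) \<and>
     (last Ps dvd A \<and> last Ps dvd B \<and> (\<forall>D. D dvd A \<and> D dvd B \<longrightarrow> D dvd last Ps))"

text \<open>A complete recursive PRS: the list Pss = [PRS_1, ..., PRS_t] (so PRS_k = Pss ! (k-1)).\<close>

definition complete_recursive_prs :: "'a::field_char_0 poly \<Rightarrow> 'a poly \<Rightarrow> 'a poly list list \<Rightarrow> bool" where
  "complete_recursive_prs F G Pss \<longleftrightarrow>
     Pss \<noteq> [] \<and>
     is_prs F G (Pss ! 0) \<and>
     (\<forall>k. 0 < k \<and> k < length Pss \<longrightarrow>
        is_prs (last (Pss ! (k - 1))) (pderiv (last (Pss ! (k - 1)))) (Pss ! k)) \<and>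
     (\<forall>k. k + 1 < length Pss \<longrightarrow> degree (last (Pss ! k)) > 0) \<and>
     degree (last (last Pss)) = 0"

definition jseq :: "'a::zero poly \<Rightarrow> 'a poly list list \<Rightarrow> nat \<Rightarrow> nat" where
  "jseq F Pss k = (if k = 0 then degree F else degree (last (Pss ! (k - 1))))"

text \<open>One step of the recursion: from N = \<bar>N^(k-1, J) (J = j_{k-1}) build \<bar>N^(k, j).\<close>

definition rec_step :: "'a::comm_ring_1 mat \<Rightarrow> nat \<Rightarrow> nat \<Rightarrow> 'a mat" where
  "rec_step N J j = (let
      C = dim_col N; R = dim_row N; RU = R - (J + 1);
      b = 2 * J - 2 * j - 1; e = J - j - 1;
      NL = (\<lambda>i c. N $$ (RU + i, c))
    in mat (b * RU + (2 * J - j - 1)) (b * C) (\<lambda>(r, c).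
      let bc = c div C; cc = c mod C in
      if r < b * RU then
        (if r div RU = bc then N $$ (r mod RU, cc) else 0)
      else (let s = r - b * RU in
        if bc < e then
          (if bc \<le> s \<and> s \<le> bc + J then NL (s - bc) cc else 0)
        else (let s' = bc - e in
          (if s' \<le> s \<and> s < s' + J then of_nat (J - (s - s')) * NL (s - s') cc else 0)))))"

fun rec_mat :: "'a::comm_ring_1 poly \<Rightarrow> 'a poly \<Rightarrow> (nat \<Rightarrow> nat) \<Rightarrow> nat \<Rightarrow> nat \<Rightarrow> 'a mat" where
  "rec_mat F G js 0 j = 0\<^sub>m 0 0"
| "rec_mat F G js (Suc 0) j = subres_mat (degree F) (degree G) F G j"
| "rec_mat F G js (Suc (Suc k)) j = rec_step (rec_mat F G js (Suc k) (js (Suc k))) (js (Suc k)) j"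

definition rec_subres :: "'a::comm_ring_1 poly \<Rightarrow> 'a poly \<Rightarrow> (nat \<Rightarrow> nat) \<Rightarrow> nat \<Rightarrow> nat \<Rightarrow> 'a poly" where
  "rec_subres F G js k j = subres_poly (rec_mat F G js k j) j"

fun nested_subres :: "'a::idom poly \<Rightarrow> 'a poly \<Rightarrow> (nat \<Rightarrow> nat) \<Rightarrow> nat \<Rightarrow> nat \<Rightarrow> 'a poly" where
  "nested_subres F G js 0 j = 0"
| "nested_subres F G js (Suc 0) j = subres_poly (subres_mat (degree F) (degree G) F G j) j"
| "nested_subres F G js (Suc (Suc k)) j =
     (let S = nested_subres F G js (Suc k) (js (Suc k)) in
      subres_poly (subres_mat (js (Suc k)) (js (Suc k) - 1) S (pderiv S) j) j)"

definition bcoef :: "(nat \<Rightarrow> nat) \<Rightarrow> nat \<Rightarrow> nat \<Rightarrow> nat" where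
  "bcoef js k j = (if k \<le> 1 then 1 else 2 * js (k - 1) - 2 * j - 1)"

text \<open>u_{k,j} for k \<ge> 2 (m = js 0, n = deg G).\<close>
definition ucoef :: "(nat \<Rightarrow> nat) \<Rightarrow> nat \<Rightarrow> nat \<Rightarrow> nat \<Rightarrow> nat" where
  "ucoef js n k j = (js 0 + n - 2 * js 1) *
      (\<Prod>l\<in>{2..k-1}. 2 * js (l - 1) - 2 * js l - 1) * bcoef js k j"

definition ucoef_k :: "(nat \<Rightarrow> nat) \<Rightarrow> nat \<Rightarrow> nat \<Rightarrow> nat" where
  "ucoef_k js n k = (if k \<le> 1 then js 0 + n - 2 * js 1 else ucoef js n k (js k))"

definition rcoef :: "(nat \<Rightarrow> nat) \<Rightarrow> nat \<Rightarrow> nat \<Rightarrow> nat \<Rightarrow> 'a::comm_ring_1" where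
  "rcoef js n k j = (if k \<le> 1 then 1 else
      (-1) ^ ((ucoef_k js n (k - 1) - 1) * (\<Sum>i\<in>{1..<bcoef js k j}. i)))"

primrec Rprime :: "(nat \<Rightarrow> nat) \<Rightarrow> nat \<Rightarrow> nat \<Rightarrow> 'a::comm_ring_1" where
  "Rprime js n 0 = 1"
| "Rprime js n (Suc k) = Rprime js n k ^ bcoef js (Suc k) (js (Suc k)) * rcoef js n (Suc k) (js (Suc k))"

end

(* One step of the recursion is an instance of a block determinant identity.  If U is n x (n+1),
   then a matrix with upper part diag(U,...,U) (b copies) and b lower rows made of row vectors
   v i s of length n+1 has determinant (-1)^(n(1+...+(b-1))) * det [ det [U; v i s] ].  With
   v i s the shifted rows of N_L and N'_L, the inner determinants are exactly the coefficients
   of the previous subresultant and of its derivative, so the outer matrix is the subresultant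
   matrix of that pair.  The constants then arise by induction from the homogeneity of degree b
   of the outer determinant. *)
theory Submission
  imports Defs "Jordan_Normal_Form.Char_Poly"
begin

section \<open>Block-diagonal copies and the permutation that gathers the last columns of the
  blocks\<close>

lemma block_index_cases:
  fixes c b n :: nat
  assumes "c < Suc b * n"
  obtains "c < b * n" "c div n < b" "c mod n < n"
  | cc where "c = b * n + cc" "cc < n" "c div n = b" "c mod n = cc"
proof (cases "c < b * n")
  case True
  with that(1) assms show ?thesis
    by (cases "n = 0") (auto simp: less_mult_imp_div_less)
next
  case False
  then obtain cc where "c = b * n + cc" using le_Suc_ex not_less by blast
  moreover have "cc < n" using assms calculation by simp
  ultimately show ?thesis using that(2) by simp
qed

lemma block_index_less:
  fixes s cc b n :: nat
  assumes "s < b" "cc < n"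
  shows "s * n + cc < b * n"
proof -
  have "s * n + cc < Suc s * n" using assms by simp
  also have "\<dots> \<le> b * n" using assms by (intro mult_right_mono) auto
  finally show ?thesis .
qed

definition diag_copies :: "nat \<Rightarrow> nat \<Rightarrow> 'a::zero mat \<Rightarrow> 'a mat" where
  "diag_copies b n A = mat (b * n) (b * n) (\<lambda>(r, c).
     if r div n = c div n then A $$ (r mod n, c mod n) else 0)"

lemma diag_copies_carrier [simp]: "diag_copies b n A \<in> carrier_mat (b * n) (b * n)"
  by (simp add: diag_copies_def)

lemma det_diag_copies:
  fixes A :: "'a::idom mat"
  assumes A: "A \<in> carrier_mat n n"
  shows "det (diag_copies b n A) = det A ^ b"
proof (induction b)
  case 0
  then show ?case by (simp add: diag_copies_def)
next
  case (Suc b)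
  let ?B = "four_block_mat (diag_copies b n A) (0\<^sub>m (b * n) n) (0\<^sub>m n (b * n)) A"
  have "diag_copies (Suc b) n A = ?B"
  proof (rule eq_matI)
    fix r c assume "r < dim_row ?B" "c < dim_col ?B"
    then have r: "r < Suc b * n" and c: "c < Suc b * n"
      using A by (auto simp: diag_copies_def)
    from r show "diag_copies (Suc b) n A $$ (r, c) = ?B $$ (r, c)"
    proof (cases rule: block_index_cases)
      case 1
      note R = 1
      from c show ?thesis
        by (cases rule: block_index_cases) (use r c R A in \<open>auto simp: diag_copies_def\<close>)
    next
      case (2 rr)
      note R = 2
      from c show ?thesis
        by (cases rule: block_index_cases) (use r c R A in \<open>auto simp: diag_copies_def\<close>)
    qed
  qed (use A in \<open>auto simp: diag_copies_def\<close>)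
  then show ?case
    using det_four_block_mat_upper_right_zero[OF diag_copies_carrier refl _ A, of "0\<^sub>m n (b * n)" b n A]
      Suc by (simp add: mult.commute)
qed

text \<open>Moves the last column of every block of width \<open>n + 1\<close> to the end.\<close>

definition gather :: "nat \<Rightarrow> nat \<Rightarrow> nat \<Rightarrow> nat" where
  "gather n b c = (if c mod Suc n < n then c div Suc n * n + c mod Suc n else b * n + c div Suc n)"

lemma gather_less:
  assumes "c < b * Suc n"
  shows "gather n b c < b * Suc n"
proof -
  have s: "c div Suc n < b" using assms by (simp add: less_mult_imp_div_less)
  then have "c div Suc n * n + c mod Suc n < b * n" if "c mod Suc n < n"
    using that by (rule block_index_less)
  with s show ?thesis by (auto simp: gather_def)
qed

definition gather_mat :: "nat \<Rightarrow> nat \<Rightarrow> 'a::{zero,one} mat" where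
  "gather_mat n b = mat (b * Suc n) (b * Suc n) (\<lambda>(r, c). if r = gather n b c then 1 else 0)"

lemma gather_mat_carrier [simp]: "gather_mat n b \<in> carrier_mat (b * Suc n) (b * Suc n)"
  by (simp add: gather_mat_def)

text \<open>Column \<open>c\<close> of \<open>gather_mat n b\<close> has its only one in row
  \<open>gather n b c\<close>. Right multiplication therefore brings columns in gathered order back
  to block order.\<close>

lemma mult_gather_mat:
  fixes M :: "'a::comm_ring_1 mat"
  assumes "M \<in> carrier_mat nr (b * Suc n)" "r < nr" "c < b * Suc n"
  shows "(M * gather_mat n b) $$ (r, c) = M $$ (r, gather n b c)"
proof -
  have "(M * gather_mat n b) $$ (r, c) =
      (\<Sum>i\<in>{0..<b * Suc n}. M $$ (r, i) * (if i = gather n b c then 1 else 0))"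
    using assms by (auto simp: gather_mat_def scalar_prod_def intro!: sum.cong)
  also have "\<dots> = M $$ (r, gather n b c)"
    using gather_less[OF assms(3)] by (simp add: if_distrib sum.delta cong: if_cong)
  finally show ?thesis .
qed

text \<open>Moving the top row below the other \<open>n\<close> rows produces the identity, at the
  cost of \<open>n\<close> transpositions.\<close>

lemma det_cyclic_shift:
  "det (mat (Suc n) (Suc n) (\<lambda>(r, c). if r = (if c < n then Suc c else 0) then 1 else 0)) =
     ((-1) ^ n :: 'a::comm_ring_1)"
proof -
  let ?A = "mat (Suc n) (Suc n) (\<lambda>(r, c). if r = (if c < n then Suc c else 0) then 1 else 0) :: 'a mat"
  have A: "?A \<in> carrier_mat (n + 1) (n + 1)" by simp
  have "mat (n + 1) (n + 1) (\<lambda>(i, j). ?A $$ (if i < n then i + 1 else i - n, j)) = 1\<^sub>m (n + 1)"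
    by (rule eq_matI) auto
  with det_swap_rows[OF A] show ?thesis by simp
qed

text \<open>Adding a block to \<open>b\<close> blocks contributes the sign
  \<open>(-1) ^ (n * b)\<close>. A row exchange gives \<open>(-1) ^ (n * (b + 1))\<close>, the
  cyclic shift left in the new block gives \<open>(-1) ^ n\<close>, and the surplus exponent
  \<open>2 * n\<close> is even.\<close>

lemma det_gather_mat:
  "det (gather_mat n b) = ((-1) ^ (n * (\<Sum>i\<in>{1..<b}. i)) :: 'a::idom)"
proof (induction b)
  case 0
  then show ?case by (simp add: gather_mat_def)
next
  case (Suc b)
  let ?m = "Suc b * Suc n"
  let ?Q = "mat (Suc n) (Suc n) (\<lambda>(r, c). if r = (if c < n then Suc c else 0) then 1 else 0) :: 'a mat"
  let ?B = "four_block_mat (gather_mat n b) (0\<^sub>m (b * Suc n) (Suc n)) (0\<^sub>m (Suc n) (b * Suc n)) ?Q"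
  \<comment> \<open>The final \<open>b + 1\<close> rows, which belong to the last columns of the
    blocks, pass above the \<open>n\<close> rows of the new block. This makes the matrix block
    diagonal.\<close>
  let ?S = "mat ?m ?m (\<lambda>(i, j). gather_mat n (Suc b) $$
      (if i < b * n then i else if i < b * n + (b + 1) then i + n else i - (b + 1), j)) :: 'a mat"
  have m: "?m = b * Suc n + Suc n" by simp
  have B: "?B \<in> carrier_mat ?m ?m"
    unfolding m by (rule four_block_carrier_mat[OF gather_mat_carrier]) simp
  have "?S = ?B"
  proof (rule eq_matI)
    fix r c assume "r < dim_row ?B" "c < dim_col ?B"
    then have r: "r < ?m" and c: "c < ?m" using B by auto
    let ?r' = "if r < b * n then r else if r < b * n + (b + 1) then r + n else r - (b + 1)"
    have S: "?S $$ (r, c) = (if ?r' = gather n (Suc b) c then 1 else 0)"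
      using r c by (auto simp: gather_mat_def)
    from c show "?S $$ (r, c) = ?B $$ (r, c)"
    proof (cases rule: block_index_cases)
      case 1
      have B': "?B $$ (r, c) = (if r = gather n b c then 1 else 0)"
        using gather_less[OF 1(1)] 1 r c by (auto simp: gather_mat_def)
      have s: "c div Suc n * n + c mod Suc n < b * n" if "c mod Suc n < n"
        using that 1 by (intro block_index_less) auto
      have "?r' = gather n (Suc b) c \<longleftrightarrow> r = gather n b c"
        using s 1 r unfolding gather_def by auto
      then show ?thesis using S B' by simp
    next
      case (2 cc)
      have B': "?B $$ (r, c) = (if r < b * Suc n then 0
          else if r - b * Suc n = (if cc < n then Suc cc else 0) then 1 else 0)"
        using 2 r c by (auto simp: gather_mat_def)
      have "?r' = gather n (Suc b) c \<longleftrightarrow>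
          \<not> r < b * Suc n \<and> r - b * Suc n = (if cc < n then Suc cc else 0)"
        using 2 r unfolding gather_def by auto
      then show ?thesis using S B' by simp
    qed
  qed (use B in auto)
  moreover have "det (gather_mat n (Suc b)) = (-1) ^ (n * (b + 1)) * det ?S"
    by (rule det_swap_final_rows[OF gather_mat_carrier]) simp
  moreover have "det ?B = det (gather_mat n b) * det ?Q"
    by (rule det_four_block_mat_upper_right_zero[OF gather_mat_carrier]) auto
  ultimately have "det (gather_mat n (Suc b)) =
      (-1) ^ (n * (b + 1)) * ((-1) ^ (n * (\<Sum>i\<in>{1..<b}. i)) * (-1) ^ n :: 'a)"
    using Suc det_cyclic_shift[where ?'a = 'a, of n] by simp
  also have "\<dots> = (-1) ^ (n * (b + 1) + (n * (\<Sum>i\<in>{1..<b}. i) + n))"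
    by (simp only: power_add)
  also have "n * (b + 1) + (n * (\<Sum>i\<in>{1..<b}. i) + n) = 2 * n + n * (b + (\<Sum>i\<in>{1..<b}. i))"
    by (simp add: algebra_simps)
  also have "(-1) ^ (2 * n + n * (b + (\<Sum>i\<in>{1..<b}. i))) =
      ((-1) ^ (n * (b + (\<Sum>i\<in>{1..<b}. i))) :: 'a)"
    by (simp add: power_add power_mult)
  also have "b + (\<Sum>i\<in>{1..<b}. i) = (\<Sum>i\<in>{1..<Suc b}. i)"
    by (cases b) (auto simp: sum.atLeastLessThan_Suc)
  finally show ?case .
qed

section \<open>Bordered determinants and the block determinant identity\<close>

definition bordered :: "nat \<Rightarrow> (nat \<Rightarrow> nat \<Rightarrow> 'a) \<Rightarrow> (nat \<Rightarrow> 'a) \<Rightarrow> 'a mat" where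
  "bordered n U w = mat (Suc n) (Suc n) (\<lambda>(r, c). if r < n then U r c else w c)"

lemma bordered_carrier [simp]: "bordered n U w \<in> carrier_mat (Suc n) (Suc n)"
  by (simp add: bordered_def)

text \<open>A cofactor along the last row does not see that row, so the zero row stands in for any
  border.\<close>

definition border_cofactor :: "nat \<Rightarrow> (nat \<Rightarrow> nat \<Rightarrow> 'a::comm_ring_1) \<Rightarrow> nat \<Rightarrow> 'a" where
  "border_cofactor n U c = cofactor (bordered n U (\<lambda>_. 0)) n c"

text \<open>Laplace expansion along the border: the determinant is a linear form in \<open>w\<close>
  whose coefficients depend on \<open>U\<close> alone.\<close>

lemma det_bordered:
  fixes U :: "nat \<Rightarrow> nat \<Rightarrow> 'a::comm_ring_1"
  shows "det (bordered n U w) = (\<Sum>c<Suc n. w c * border_cofactor n U c)"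
proof -
  have "cofactor (bordered n U w) n c = border_cofactor n U c" if "c < Suc n" for c
  proof -
    have "mat_delete (bordered n U w) n c = mat_delete (bordered n U (\<lambda>_. 0)) n c"
      using that by (intro eq_matI) (auto simp: mat_delete_def bordered_def)
    then show ?thesis by (simp add: cofactor_def border_cofactor_def)
  qed
  then show ?thesis
    by (subst laplace_expansion_row[OF bordered_carrier, of n])
      (auto intro!: sum.cong simp: bordered_def)
qed

text \<open>Bordering \<open>U\<close> by its own row \<open>r\<close> gives a matrix with two equal
  rows. The cofactor vector thus lies in the kernel of \<open>U\<close>.\<close>

lemma sum_row_border_cofactor:
  fixes U :: "nat \<Rightarrow> nat \<Rightarrow> 'a::comm_ring_1"
  assumes "r < n"
  shows "(\<Sum>c<Suc n. U r c * border_cofactor n U c) = 0"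
proof -
  have "row (bordered n U (U r)) r = row (bordered n U (U r)) n"
    using assms by (intro eq_vecI) (auto simp: bordered_def)
  then have "det (bordered n U (U r)) = 0"
    using assms by (intro det_identical_rows[OF bordered_carrier, of r n]) auto
  then show ?thesis by (simp add: det_bordered)
qed

text \<open>The cofactor sign is \<open>(-1) ^ (n + n) = 1\<close>. This value becomes the last
  diagonal entry of the column operation \<open>E\<close>.\<close>

lemma border_cofactor_last:
  fixes U :: "nat \<Rightarrow> nat \<Rightarrow> 'a::comm_ring_1"
  shows "border_cofactor n U n = det (mat n n (\<lambda>(r, c). U r c))"
proof -
  have "mat_delete (bordered n U (\<lambda>_. 0)) n n = mat n n (\<lambda>(r, c). U r c)"
    by (intro eq_matI) (auto simp: mat_delete_def bordered_def)
  then show ?thesis by (simp add: border_cofactor_def cofactor_def)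
qed

lemma mult_diag_copies:
  fixes M :: "'a::comm_ring_1 mat"
  assumes "M \<in> carrier_mat nr (b * n)" "A \<in> carrier_mat n n" "r < nr" "c < b * n"
  shows "(M * diag_copies b n A) $$ (r, c) =
    (\<Sum>i<n. M $$ (r, c div n * n + i) * A $$ (i, c mod n))"
proof -
  let ?s = "c div n"
  have n: "n > 0" using assms(4) by (cases n) auto
  have s: "?s < b" using assms(4) by (simp add: less_mult_imp_div_less)
  have lt: "?s * n + i < b * n" if "i < n" for i
    using s that by (rule block_index_less)
  have "(M * diag_copies b n A) $$ (r, c) =
      (\<Sum>i\<in>{0..<b * n}. M $$ (r, i) * (if i div n = ?s then A $$ (i mod n, c mod n) else 0))"
    using assms by (auto simp: diag_copies_def scalar_prod_def intro!: sum.cong)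
  also have "\<dots> = (\<Sum>i\<in>(\<lambda>i. ?s * n + i) ` {..<n}. M $$ (r, i) * A $$ (i mod n, c mod n))"
  proof (rule sum.mono_neutral_cong_right)
    show "\<forall>i\<in>{0..<b * n} - (\<lambda>i. ?s * n + i) ` {..<n}.
        M $$ (r, i) * (if i div n = ?s then A $$ (i mod n, c mod n) else 0) = 0"
    proof
      fix i assume i: "i \<in> {0..<b * n} - (\<lambda>i. ?s * n + i) ` {..<n}"
      have "i div n \<noteq> ?s"
      proof
        assume "i div n = ?s"
        then have "i = ?s * n + i mod n" by (metis div_mult_mod_eq)
        with i n show False by auto
      qed
      then show "M $$ (r, i) * (if i div n = ?s then A $$ (i mod n, c mod n) else 0) = 0" by simp
    qed
  qed (use lt in auto)
  also have "\<dots> = (\<Sum>i<n. M $$ (r, ?s * n + i) * A $$ (i, c mod n))"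
    by (subst sum.reindex) (auto simp: inj_on_def)
  finally show ?thesis .
qed

text \<open>Here \<open>v i s\<close> is the part of lower row \<open>i\<close> inside column block
  \<open>s\<close>. The \<open>b * n\<close> upper and \<open>b\<close> lower rows make the matrix
  square.\<close>

definition bordered_copies ::
    "nat \<Rightarrow> nat \<Rightarrow> (nat \<Rightarrow> nat \<Rightarrow> 'a::zero) \<Rightarrow> (nat \<Rightarrow> nat \<Rightarrow> nat \<Rightarrow> 'a) \<Rightarrow> 'a mat" where
  "bordered_copies n b U v = mat (b * Suc n) (b * Suc n) (\<lambda>(r, c).
     if r < b * n then (if r div n = c div Suc n then U (r mod n) (c mod Suc n) else 0)
     else v (r - b * n) (c div Suc n) (c mod Suc n))"

lemma bordered_copies_carrier [simp]:
  "bordered_copies n b U v \<in> carrier_mat (b * Suc n) (b * Suc n)"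
  by (simp add: bordered_copies_def)

text \<open>In each block the last column is replaced by its combination with the border cofactors,
  which kills \<open>U\<close> and turns every \<open>v i s\<close> into \<open>det [U; v i s]\<close>.\<close>

lemma bordered_copies_factorization:
  fixes U :: "nat \<Rightarrow> nat \<Rightarrow> 'a::comm_ring_1" and v :: "nat \<Rightarrow> nat \<Rightarrow> nat \<Rightarrow> 'a" and n b :: nat
  defines "E \<equiv> mat (Suc n) (Suc n) (\<lambda>(r, c).
      if c < n then (if r = c then 1 else 0) else border_cofactor n U r)"
    and "T \<equiv> four_block_mat (diag_copies b n (mat n n (\<lambda>(r, c). U r c))) (0\<^sub>m (b * n) b)
      (mat b (b * n) (\<lambda>(i, c). v i (c div n) (c mod n)))
      (mat b b (\<lambda>(i, s). det (bordered n U (v i s))))"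
  shows "bordered_copies n b U v * diag_copies b (Suc n) E = T * gather_mat n b"
proof -
  let ?M = "bordered_copies n b U v"
  have E: "E \<in> carrier_mat (Suc n) (Suc n)" by (simp add: E_def)
  have T: "T \<in> carrier_mat (b * Suc n) (b * Suc n)"
    using four_block_carrier_mat[OF diag_copies_carrier, of "mat b b (\<lambda>(i, s). det (bordered n U (v i s)))" b b b n]
    unfolding T_def by (simp add: add.commute)
  show ?thesis
  proof (rule eq_matI)
    fix r c assume "r < dim_row (T * gather_mat n b)" "c < dim_col (T * gather_mat n b)"
    then have r: "r < b * Suc n" and c: "c < b * Suc n"
      using T by (auto simp: gather_mat_def)
    let ?s = "c div Suc n"
    have s: "?s < b" using c by (simp add: less_mult_imp_div_less)
    have lt: "?s * Suc n + i < b * Suc n" if "i < Suc n" for i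
      using s that by (rule block_index_less)
    have R: "r div n < b" "r mod n < n" if "r < b * n"
      using that by (cases "n = 0"; simp add: less_mult_imp_div_less)+
    have M: "?M $$ (r, ?s * Suc n + i) =
        (if r < b * n then (if r div n = ?s then U (r mod n) i else 0) else v (r - b * n) ?s i)"
      if "i < Suc n" for i
    proof -
      have "(?s * Suc n + i) div Suc n = ?s" "(?s * Suc n + i) mod Suc n = i"
        using that by (simp_all only: mod_mult_self3 mod_less div_mult_self3 div_less)
      with lt[OF that] r show ?thesis unfolding bordered_copies_def by simp
    qed
    have L: "(?M * diag_copies b (Suc n) E) $$ (r, c) =
        (\<Sum>i<Suc n. ?M $$ (r, ?s * Suc n + i) * E $$ (i, c mod Suc n))"
      by (rule mult_diag_copies[OF bordered_copies_carrier E r c])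
    have Rt: "(T * gather_mat n b) $$ (r, c) = T $$ (r, gather n b c)"
      by (rule mult_gather_mat[OF T r c])
    have "(\<Sum>i<Suc n. ?M $$ (r, ?s * Suc n + i) * E $$ (i, c mod Suc n)) = T $$ (r, gather n b c)"
    proof (cases "c mod Suc n < n")
      case True
      have "(\<Sum>i<Suc n. ?M $$ (r, ?s * Suc n + i) * E $$ (i, c mod Suc n)) =
          (\<Sum>i<Suc n. if i = c mod Suc n then ?M $$ (r, ?s * Suc n + i) else 0)"
        using True by (intro sum.cong) (auto simp: E_def)
      also have "\<dots> = ?M $$ (r, ?s * Suc n + c mod Suc n)"
        using True by (subst sum.delta) auto
      finally have 1: "(\<Sum>i<Suc n. ?M $$ (r, ?s * Suc n + i) * E $$ (i, c mod Suc n)) =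
          (if r < b * n then (if r div n = ?s then U (r mod n) (c mod Suc n) else 0)
           else v (r - b * n) ?s (c mod Suc n))"
        using M[of "c mod Suc n"] True by simp
      have "?s * n + c mod Suc n < b * n" using s True by (rule block_index_less)
      moreover have "(?s * n + c mod Suc n) div n = ?s" "(?s * n + c mod Suc n) mod n = c mod Suc n"
        using True by simp_all
      ultimately show ?thesis unfolding 1 using True r R
        by (auto simp: T_def gather_def diag_copies_def)
    next
      case False
      then have n: "c mod Suc n = n" using mod_less_divisor[of "Suc n" c] by linarith
      have "(\<Sum>i<Suc n. ?M $$ (r, ?s * Suc n + i) * E $$ (i, c mod Suc n)) =
          (\<Sum>i<Suc n. (if r < b * n then (if r div n = ?s then U (r mod n) i else 0)
            else v (r - b * n) ?s i) * border_cofactor n U i)"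
        using n M by (intro sum.cong) (auto simp: E_def)
      also have "\<dots> = (if r < b * n then 0 else det (bordered n U (v (r - b * n) ?s)))"
        using sum_row_border_cofactor[of "r mod n" n U] R by (simp add: det_bordered)
      also have "\<dots> = T $$ (r, gather n b c)"
        using n r s by (auto simp: T_def gather_def diag_copies_def)
      finally show ?thesis .
    qed
    with L Rt show "(?M * diag_copies b (Suc n) E) $$ (r, c) = (T * gather_mat n b) $$ (r, c)" by simp
  qed (use E T in \<open>auto simp: bordered_copies_def diag_copies_def gather_mat_def\<close>)
qed

text \<open>Taking determinants in the factorization leaves \<open>det ?U ^ b\<close> on both sides:
  on the left from the column operations, on the right from the upper diagonal blocks. In an
  integral domain this nonzero factor cancels.\<close>

lemma det_bordered_copies_nonzero_minor:
  fixes U :: "nat \<Rightarrow> nat \<Rightarrow> 'a::idom"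
  assumes nz: "det (mat n n (\<lambda>(r, c). U r c)) \<noteq> 0"
  shows "det (bordered_copies n b U v) =
    (-1) ^ (n * (\<Sum>i\<in>{1..<b}. i)) * det (mat b b (\<lambda>(i, s). det (bordered n U (v i s))))"
proof -
  let ?U = "mat n n (\<lambda>(r, c). U r c)"
  let ?E = "mat (Suc n) (Suc n) (\<lambda>(r, c).
      if c < n then (if r = c then 1 else 0) else border_cofactor n U r)"
  let ?W = "mat b b (\<lambda>(i, s). det (bordered n U (v i s)))"
  let ?V = "mat b (b * n) (\<lambda>(i, c). v i (c div n) (c mod n))"
  let ?T = "four_block_mat (diag_copies b n ?U) (0\<^sub>m (b * n) b) ?V ?W"
  have T: "?T \<in> carrier_mat (b * Suc n) (b * Suc n)"
    using four_block_carrier_mat[OF diag_copies_carrier, of ?W b b b n]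
    by (simp add: add.commute)
  \<comment> \<open>The matrix \<open>?E\<close> is upper triangular, with diagonal entries 1
    followed by one \<open>det ?U\<close>.\<close>
  have "map ((\<lambda>i. ?E $$ (i, i))) [0..<Suc n] = map (\<lambda>i. if i < n then 1 else det ?U) [0..<Suc n]"
    by (rule map_cong) (auto simp: border_cofactor_last)
  also have "prod_list \<dots> = det ?U"
  proof -
    have "map (\<lambda>i. if i < n then 1 else det ?U) [0..<n] = replicate n 1"
      by (rule nth_equalityI) auto
    then show ?thesis by simp
  qed
  finally have "det ?E = det ?U"
    by (subst det_upper_triangular[of _ "Suc n"]) (auto simp: upper_triangular_def diag_mat_def)
  then have "det (bordered_copies n b U v * diag_copies b (Suc n) ?E) =
      det (bordered_copies n b U v) * det ?U ^ b"
    by (subst det_mult[OF bordered_copies_carrier diag_copies_carrier])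
      (simp add: det_diag_copies[where n = "Suc n"])
  moreover have "det (?T * gather_mat n b) = det ?U ^ b * det ?W * det (gather_mat n b)"
    by (subst det_mult[OF T gather_mat_carrier])
      (simp add: det_four_block_mat_upper_right_zero[where n = "b * n" and m = b] det_diag_copies[where n = n])
  ultimately have "det (bordered_copies n b U v) * det ?U ^ b =
      (det ?W * det (gather_mat n b)) * det ?U ^ b"
    by (auto simp: bordered_copies_factorization ac_simps)
  with nz show ?thesis by (simp add: det_gather_mat)
qed

text \<open>The leading minor of \<open>U\<close> may vanish; adding \<open>x\<close> to its diagonal makes it a monic
  polynomial in \<open>x\<close>, and the identity is then specialized at \<open>x = 0\<close>.\<close>

theorem det_bordered_copies:
  fixes U :: "nat \<Rightarrow> nat \<Rightarrow> 'a::idom"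
  shows "det (bordered_copies n b U v) =
    (-1) ^ (n * (\<Sum>i\<in>{1..<b}. i)) * det (mat b b (\<lambda>(i, s). det (bordered n U (v i s))))"
proof -
  let ?U = "\<lambda>r c. if r = c then [:U r c, 1:] else [:U r c:]"
  let ?v = "\<lambda>i s c. [:v i s c:]"
  note hom_det = comm_ring_hom.hom_det[OF poly_hom.comm_ring_hom_axioms, symmetric]
  \<comment> \<open>The characteristic matrix of \<open>-U\<close> is \<open>x * I + U\<close>, so
    its determinant is a monic polynomial and hence nonzero.\<close>
  have "mat n n (\<lambda>(r, c). ?U r c) = char_poly_matrix (mat n n (\<lambda>(r, c). - U r c))"
    by (rule eq_matI) (auto simp: char_poly_matrix_def)
  then have "det (mat n n (\<lambda>(r, c). ?U r c)) \<noteq> 0"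
    using degree_monic_char_poly[of "mat n n (\<lambda>(r, c). - U r c)" n] by (auto simp: char_poly_def)
  then have eq: "det (bordered_copies n b ?U ?v) =
      (-1) ^ (n * (\<Sum>i\<in>{1..<b}. i)) * det (mat b b (\<lambda>(i, s). det (bordered n ?U (?v i s))))"
    by (rule det_bordered_copies_nonzero_minor)
  have "map_mat (\<lambda>p. poly p 0) (bordered_copies n b ?U ?v) = bordered_copies n b U v"
    by (rule eq_matI) (auto simp: bordered_copies_def)
  moreover have B: "map_mat (\<lambda>p. poly p 0) (bordered n ?U (?v i s)) = bordered n U (v i s)" for i s
    by (rule eq_matI) (auto simp: bordered_def)
  have "map_mat (\<lambda>p. poly p 0) (mat b b (\<lambda>(i, s). det (bordered n ?U (?v i s)))) =
      mat b b (\<lambda>(i, s). det (bordered n U (v i s)))"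
    by (rule eq_matI) (auto simp: hom_det B)
  ultimately show ?thesis
    using arg_cong[OF eq, of "\<lambda>p. poly p 0"] by (simp add: hom_det)
qed

lemma det_bordered_zero [simp]:
  fixes U :: "nat \<Rightarrow> nat \<Rightarrow> 'a::comm_ring_1"
  shows "det (bordered n U (\<lambda>_. 0)) = 0"
  by (simp add: det_bordered)

lemma det_bordered_mult:
  fixes U :: "nat \<Rightarrow> nat \<Rightarrow> 'a::comm_ring_1"
  shows "det (bordered n U (\<lambda>c. a * w c)) = a * det (bordered n U w)"
  by (simp only: det_bordered sum_distrib_left mult.assoc)

section \<open>One recursion step expressed through ordinary subresultants\<close>

text \<open>Names the matrix inlined in \<open>subres_poly\<close>, so that it can be rewritten by
  itself. With \<open>D\<close> columns, its last row is row \<open>D + j - \<tau>\<close> counted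
  from one.\<close>

definition subres_minor :: "'a mat \<Rightarrow> nat \<Rightarrow> nat \<Rightarrow> 'a mat" where
  "subres_minor M j \<tau> = mat (dim_col M) (dim_col M) (\<lambda>(r, c).
     if r < dim_col M - 1 then M $$ (r, c) else M $$ (dim_col M + j - \<tau> - 1, c))"

lemma subres_poly_eq: "subres_poly M j = (\<Sum>\<tau>\<le>j. monom (det (subres_minor M j \<tau>)) \<tau>)"
  by (simp add: subres_poly_def subres_minor_def)

lemma coeff_subres_poly:
  assumes "\<tau> \<le> j"
  shows "coeff (subres_poly M j) \<tau> = det (subres_minor M j \<tau>)"
  using assms by (simp add: subres_poly_eq coeff_sum)

text \<open>Each minor of \<open>rec_step N J j\<close> is a \<open>bordered_copies\<close> matrix
  whose \<open>U\<close> is the top \<open>n\<close> rows of \<open>N\<close>. By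
  \<open>det_bordered_copies\<close> it reduces to a determinant of bordered determinants, and these
  are the entries of the subresultant matrix of \<open>S\<close> and \<open>pderiv S\<close>. The
  number of blocks equals the number of columns of that matrix.\<close>

lemma subres_poly_rec_step:
  fixes N :: "'a::idom mat"
  assumes N: "N \<in> carrier_mat (Suc n + J) (Suc n)" and j: "j < J"
  defines "S \<equiv> subres_poly N J"
  shows "subres_poly (rec_step N J j) j =
    smult ((-1) ^ (n * (\<Sum>i\<in>{1..<2 * J - 2 * j - 1}. i)))
      (subres_poly (subres_mat J (J - 1) S (pderiv S) j) j)"
proof -
  let ?b = "2 * J - 2 * j - 1" and ?e = "J - j - 1"
  let ?M = "subres_mat J (J - 1) S (pderiv S) j"
  let ?U = "\<lambda>r c. N $$ (r, c)"
  let ?sgn = "(-1) ^ (n * (\<Sum>i\<in>{1..<?b}. i)) :: 'a"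
  \<comment> \<open>The part of lower row \<open>i\<close> in column block \<open>s\<close>: the
    first \<open>?e\<close> blocks carry shifted rows of \<open>N_L\<close>, the others shifted rows
    of its weighted version.\<close>
  define low where "low i s c = (if s < ?e then (if s \<le> i \<and> i \<le> s + J then N $$ (n + (i - s), c) else 0)
    else (if s - ?e \<le> i \<and> i < s - ?e + J
      then of_nat (J - (i - (s - ?e))) * N $$ (n + (i - (s - ?e)), c) else 0))" for i s c
  have dimN: "dim_row N = Suc n + J" "dim_col N = Suc n" using N by auto
  \<comment> \<open>For \<tau> \<open>= J - l\<close> the exchanged row of the minor has index
    \<open>Suc n + J - (J - l) - 1 = n + l\<close>.\<close>
  have coeffS: "det (bordered n ?U (\<lambda>c. N $$ (n + l, c))) = coeff S (J - l)" if "l \<le> J" for l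
  proof -
    have "bordered n ?U (\<lambda>c. N $$ (n + l, c)) = subres_minor N J (J - l)"
      using that by (intro eq_matI) (auto simp: bordered_def subres_minor_def dimN)
    then show ?thesis by (simp add: S_def coeff_subres_poly)
  qed
  have det_low: "det (bordered n ?U (low i s)) = ?M $$ (i, s)" if "i < ?b + j" "s < ?b" for i s
  proof -
    have dims: "i < J + (J - 1) - j" "s < J + (J - 1) - 2 * j" using that by auto
    show ?thesis
    proof (cases "s < ?e")
      case True
      then have "low i s = (if s \<le> i \<and> i \<le> s + J then (\<lambda>c. N $$ (n + (i - s), c)) else (\<lambda>_. 0))"
        by (auto simp: low_def)
      moreover have "?M $$ (i, s) = (if s \<le> i \<and> i \<le> s + J then coeff S (J - (i - s)) else 0)"
        using True dims by (auto simp: subres_mat_def)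
      ultimately show ?thesis using coeffS[of "i - s"] by auto
    next
      case False
      let ?s = "s - ?e"
      let ?P = "?s \<le> i \<and> i < ?s + J"
      have low: "low i s = (if ?P then (\<lambda>c. of_nat (J - (i - ?s)) * N $$ (n + (i - ?s), c)) else (\<lambda>_. 0))"
        using False by (auto simp: low_def)
      \<comment> \<open>The weight leaves the border by linearity. Then
        \<open>(J - l) * coeff S (J - l)\<close> is the coefficient of \<open>pderiv S\<close> in
        degree \<open>J - l - 1\<close>, where \<open>l = i - ?s\<close>.\<close>
      have 1: "det (bordered n ?U (low i s)) =
          (if ?P then of_nat (J - (i - ?s)) * coeff S (J - (i - ?s)) else 0)"
      proof (cases ?P)
        case True
        then have "i - ?s \<le> J" by linarith
        with True low show ?thesis by (simp only: det_bordered_mult coeffS if_True simp_thms)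
      next
        case False
        with low show ?thesis by (simp only: det_bordered_zero if_False)
      qed
      have e: "J - Suc 0 - j = ?e" by simp
      have "?M $$ (i, s) = (if ?s \<le> i \<and> i \<le> ?s + (J - 1) then coeff (pderiv S) (J - 1 - (i - ?s)) else 0)"
        using False dims by (simp add: subres_mat_def Let_def e)
      also have "\<dots> = (if ?P then of_nat (J - (i - ?s)) * coeff S (J - (i - ?s)) else 0)"
      proof -
        have "?s \<le> i \<and> i \<le> ?s + (J - 1) \<longleftrightarrow> ?P" using j by auto
        moreover have "Suc (J - 1 - (i - ?s)) = J - (i - ?s)" if ?P
        proof -
          have "Suc (J - 1 - x) = J - x" if "x < J" for x using that by simp
          moreover have "i - ?s < J" using that by linarith
          ultimately show ?thesis .
        qed
        ultimately show ?thesis by (simp add: coeff_pderiv)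
      qed
      finally show ?thesis using 1 by simp
    qed
  qed
  define B where "B = ?b"
  have B: "B \<ge> 1" and height: "2 * J - j - 1 = B + j" using j by (auto simp: B_def)
  have dimR: "dim_col (rec_step N J j) = B * Suc n"
    by (simp add: rec_step_def Let_def dimN B_def)
  have "dim_col ?M = B" by (simp add: subres_mat_def B_def)
  note dimM = this[unfolded One_nat_def]
  have rec_step_entry: "rec_step N J j $$ (r, c) =
      (if r < B * n then (if r div n = c div Suc n then N $$ (r mod n, c mod Suc n) else 0)
       else low (r - B * n) (c div Suc n) (c mod Suc n))"
    if "r < B * n + (B + j)" "c < B * Suc n" for r c
  proof -
    have "Suc n + J - (J + 1) = n" by simp
    then show ?thesis
      using that unfolding rec_step_def Let_def dimN B_def[symmetric] height by (simp add: low_def)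
  qed
  have minor: "det (subres_minor (rec_step N J j) j \<tau>) = ?sgn * det (subres_minor ?M j \<tau>)"
    if \<tau>: "\<tau> \<le> j" for \<tau>
  proof -
    \<comment> \<open>The upper rows are common to all minors. Among the \<open>B + j\<close> lower
      rows the minor keeps the first \<open>B - 1\<close> and one further row selected by
      \<tau>.\<close>
    let ?row = "\<lambda>i. if i < B - 1 then i else B + j - \<tau> - 1"
    let ?R = "bordered_copies n B ?U (\<lambda>i. low (?row i))"
    have "subres_minor (rec_step N J j) j \<tau> = ?R"
    proof (rule eq_matI)
      fix r c assume "r < dim_row ?R" "c < dim_col ?R"
      then have r: "r < B * n + B" and c: "c < B * Suc n" by (auto simp: bordered_copies_def)
      \<comment> \<open>Row \<open>r'\<close> of the recursive matrix is row \<open>r\<close> of the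
        minor. Since \<open>B \<ge> 1\<close> and \<tau> \<open>\<le> j\<close>, the exchanged row
        always lies in the lower part.\<close>
      define r' where "r' = (if r < B * n + B - 1 then r else B * n + B + j - \<tau> - 1)"
      have "r' < B * n + (B + j)" using r B \<tau> by (auto simp: r'_def)
      note entry = rec_step_entry[OF this c]
      have R: "?R $$ (r, c) =
          (if r < B * n then (if r div n = c div Suc n then N $$ (r mod n, c mod Suc n) else 0)
           else low (?row (r - B * n)) (c div Suc n) (c mod Suc n))"
        using r c by (simp add: bordered_copies_def)
      have "subres_minor (rec_step N J j) j \<tau> $$ (r, c) = rec_step N J j $$ (r', c)"
        using r c by (simp add: subres_minor_def dimR r'_def add.commute)
      also have "\<dots> = ?R $$ (r, c)"
      proof (cases "r < B * n")
        case True
        then have "r' = r" using B by (auto simp: r'_def)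
        with True entry R show ?thesis by (simp only: if_True)
      next
        case False
        then have "\<not> r' < B * n" using B \<tau> by (auto simp: r'_def)
        moreover have "r' - B * n = ?row (r - B * n)"
        proof (cases "r < B * n + B - 1")
          case True
          moreover have "r - B * n < B - 1" using True False by linarith
          ultimately show ?thesis by (simp only: r'_def if_True)
        next
          case F: False
          moreover have "\<not> r - B * n < B - 1" using F False by linarith
          moreover have "B * n + B + j - \<tau> - 1 - B * n = B + j - \<tau> - 1" by simp
          ultimately show ?thesis by (simp only: r'_def if_False)
        qed
        ultimately show ?thesis using False entry R by (simp only: if_False)
      qed
      finally show "subres_minor (rec_step N J j) j \<tau> $$ (r, c) = ?R $$ (r, c)" .
    qed (simp_all add: subres_minor_def dimR bordered_copies_def)
    then have "det (subres_minor (rec_step N J j) j \<tau>) =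
        ?sgn * det (mat B B (\<lambda>(i, s). det (bordered n ?U (low (?row i) s))))"
      by (simp only: det_bordered_copies B_def)
    also have "mat B B (\<lambda>(i, s). det (bordered n ?U (low (?row i) s))) = subres_minor ?M j \<tau>"
    proof (rule eq_matI)
      fix i s assume "i < dim_row (subres_minor ?M j \<tau>)" "s < dim_col (subres_minor ?M j \<tau>)"
      then have i: "i < B" and s: "s < B" by (simp_all add: subres_minor_def dimM)
      have "?row i < ?b + j" using i \<tau> by (auto simp: B_def)
      then have "det (bordered n ?U (low (?row i) s)) = ?M $$ (?row i, s)"
        using s unfolding B_def by (rule det_low)
      moreover have "subres_minor ?M j \<tau> $$ (i, s) = ?M $$ (?row i, s)"
        using i s by (simp add: subres_minor_def dimM)
      ultimately show "mat B B (\<lambda>(i, s). det (bordered n ?U (low (?row i) s))) $$ (i, s) =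
          subres_minor ?M j \<tau> $$ (i, s)"
        using i s by (simp only: index_mat prod.case)
    qed (simp_all add: subres_minor_def dimM)
    finally show ?thesis .
  qed
  show ?thesis
    unfolding subres_poly_eq by (simp add: minor smult_sum2 smult_monom)
qed

section \<open>Homogeneity of subresultants and sizes of the recursive matrices\<close>

lemma subres_mat_smult:
  "subres_mat p q (smult a A) (smult a B) j = a \<cdot>\<^sub>m subres_mat p q A B j"
  by (rule eq_matI) (auto simp: subres_mat_def Let_def)

text \<open>Every minor has \<open>dim_col M\<close> rows, each scaled by \<open>a\<close>. The
  bound on \<open>dim_row M\<close> keeps the exchanged row inside the matrix.\<close>

lemma subres_poly_smult:
  assumes "dim_col M + j \<le> dim_row M"
  shows "subres_poly (a \<cdot>\<^sub>m M) j = smult (a ^ dim_col M) (subres_poly M j)"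
proof -
  have "det (subres_minor (a \<cdot>\<^sub>m M) j \<tau>) = a ^ dim_col M * det (subres_minor M j \<tau>)" for \<tau>
  proof -
    have "subres_minor (a \<cdot>\<^sub>m M) j \<tau> = a \<cdot>\<^sub>m subres_minor M j \<tau>"
      using assms by (intro eq_matI) (auto simp: subres_minor_def)
    then show ?thesis by (simp add: subres_minor_def)
  qed
  then show ?thesis
    by (simp add: subres_poly_eq smult_sum2 smult_monom)
qed

text \<open>With \<open>b = 2 * J - 2 * j - 1\<close>, the \<open>b\<close> blocks keep
  \<open>C - 1\<close> upper rows each and the lower part has \<open>b + j\<close> rows, so
  \<open>b * (C - 1) + b + j = b * C + j\<close>. The excess of rows over columns passes from
  \<open>J\<close> to \<open>j\<close>.\<close>

lemma rec_step_carrier: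
  assumes "N \<in> carrier_mat (C + J) C" "C > 0" "j < J"
  shows "rec_step N J j \<in> carrier_mat ((2 * J - 2 * j - 1) * C + j) ((2 * J - 2 * j - 1) * C)"
proof -
  define b where "b = 2 * J - 2 * j - 1"
  have "2 * J - j - 1 = b + j" using assms(3) by (simp add: b_def)
  moreover obtain c where "C = Suc c" using assms(2) gr0_implies_Suc by blast
  ultimately have "b * (C + J - (J + 1)) + (2 * J - j - 1) = b * C + j" by simp
  with assms(1) show ?thesis unfolding rec_step_def Let_def b_def[symmetric] by simp
qed

text \<open>The last factor of \<open>ucoef_k js n k\<close> joins the product and a new last factor
  is appended. For \<open>k = 1\<close> the product is empty.\<close>

lemma ucoef_k_Suc:
  assumes "k \<ge> 1"
  shows "ucoef_k js n (Suc k) = ucoef_k js n k * (2 * js k - 2 * js (Suc k) - 1)"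
proof (cases "k = 1")
  case True
  then show ?thesis by (simp add: ucoef_k_def ucoef_def bcoef_def)
next
  case False
  with assms have k: "2 \<le> k" by simp
  then have "{2..k} = insert k {2..k - 1}" by auto
  with k have "(\<Prod>l\<in>{2..k}. 2 * js (l - 1) - 2 * js l - 1) =
      (\<Prod>l\<in>{2..k - 1}. 2 * js (l - 1) - 2 * js l - 1) * (2 * js (k - 1) - 2 * js k - 1)"
    by (simp add: mult.commute)
  with k show ?thesis by (simp add: ucoef_k_def ucoef_def bcoef_def)
qed

text \<open>An upper bound for the degree of the second member of the \<open>k\<close>-th PRS.\<close>

definition sbound :: "(nat \<Rightarrow> nat) \<Rightarrow> nat \<Rightarrow> nat \<Rightarrow> nat" where
  "sbound js n k = (if k \<le> 1 then n else js (k - 1))"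

text \<open>The number \<open>ucoef_k\<close> counts the columns. The strict bounds on
  \<open>js\<close> make every truncated subtraction genuine and every factor positive.\<close>

lemma rec_mat_carrier:
  assumes "js 0 = degree F" "degree G < degree F" "k \<ge> 1"
    and "\<And>i. 1 \<le> i \<Longrightarrow> i \<le> k \<Longrightarrow> js i < sbound js (degree G) i"
  shows "rec_mat F G js k (js k) \<in>
      carrier_mat (ucoef_k js (degree G) k + js k) (ucoef_k js (degree G) k) \<and>
    ucoef_k js (degree G) k > 0"
  using assms(3,4)
proof (induction k rule: nat_induct_at_least)
  case base
  then show ?case
    using base[of 1] assms(1,2) by (simp add: ucoef_k_def subres_mat_def sbound_def)
next
  case (Suc k)
  then obtain l where l: "k = Suc l" by (cases k) auto
  have lt: "js (Suc k) < js k" using Suc.prems[of "Suc k"] Suc.hyps by (simp add: sbound_def)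
  have IH: "rec_mat F G js k (js k) \<in>
      carrier_mat (ucoef_k js (degree G) k + js k) (ucoef_k js (degree G) k)"
    "ucoef_k js (degree G) k > 0"
    using Suc by auto
  have "rec_mat F G js (Suc k) (js (Suc k)) = rec_step (rec_mat F G js k (js k)) (js k) (js (Suc k))"
    by (simp add: l)
  then show ?case
    using rec_step_carrier[OF IH lt] IH(2) lt
    by (simp add: ucoef_k_Suc[OF Suc.hyps] mult.commute)
qed

section \<open>Induction over the recursion\<close>

text \<open>A step yields the sign \<open>rcoef\<close> from the block identity. It also yields a
  power of the constant accumulated so far, whose exponent is the number of columns of the next
  subresultant matrix.\<close>

lemma rec_subres_eq:
  fixes F G :: "'a::idom poly"
  assumes "js 0 = degree F" "degree G < degree F" "k \<ge> 1"
    and "\<And>i. 1 \<le> i \<Longrightarrow> i < k \<Longrightarrow> js i < sbound js (degree G) i"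
    and "j < sbound js (degree G) k"
  shows "rec_subres F G js k j =
    smult (Rprime js (degree G) (k - 1) ^ bcoef js k j * rcoef js (degree G) k j)
      (nested_subres F G js k j)"
  using assms(3-)
proof (induction k arbitrary: j rule: nat_induct_at_least)
  case base
  then show ?case by (simp add: rec_subres_def rcoef_def)
next
  case (Suc k)
  let ?n = "degree G" and ?J = "js k"
  let ?S = "nested_subres F G js k ?J"
  let ?M = "subres_mat ?J (?J - 1) ?S (pderiv ?S) j"
  let ?R = "Rprime js ?n k :: 'a"
  from Suc obtain l where l: "k = Suc l" by (cases k) auto
  have j: "j < ?J" using Suc.prems(2) Suc.hyps by (simp add: sbound_def)
  have b: "bcoef js (Suc k) j = 2 * ?J - 2 * j - 1" using Suc.hyps by (simp add: bcoef_def)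
  have "js k < sbound js ?n k" using Suc.prems(1)[of k] Suc.hyps by simp
  \<comment> \<open>At \<open>j = js k\<close> the constant of the induction hypothesis is exactly
    the recursive definition of \<open>Rprime js ?n k\<close>.\<close>
  then have S: "subres_poly (rec_mat F G js k ?J) ?J = smult ?R ?S"
    using Suc.IH[of ?J] Suc.prems(1) by (simp add: rec_subres_def l)
  have C: "rec_mat F G js k ?J \<in> carrier_mat (ucoef_k js ?n k + ?J) (ucoef_k js ?n k) \<and>
      ucoef_k js ?n k > 0"
    by (rule rec_mat_carrier[of js F G k, OF assms(1,2) Suc.hyps]) (use Suc.prems(1) in simp)
  \<comment> \<open>Bordering needs one column more than rows, hence the exponent
    \<open>ucoef_k - 1\<close> in \<open>rcoef\<close>.\<close>
  then obtain u where u: "ucoef_k js ?n k = Suc u" using gr0_implies_Suc by blast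
  with C have N: "rec_mat F G js k ?J \<in> carrier_mat (Suc u + ?J) (Suc u)" by simp
  have "rec_subres F G js (Suc k) j = subres_poly (rec_step (rec_mat F G js k ?J) ?J j) j"
    by (simp add: rec_subres_def l)
  also have "\<dots> = smult ((-1) ^ (u * (\<Sum>i\<in>{1..<2 * ?J - 2 * j - 1}. i)))
      (subres_poly (subres_mat ?J (?J - 1) (smult ?R ?S) (pderiv (smult ?R ?S)) j) j)"
    using subres_poly_rec_step[OF N j] by (simp only: S)
  also have "(-1) ^ (u * (\<Sum>i\<in>{1..<2 * ?J - 2 * j - 1}. i)) = (rcoef js ?n (Suc k) j :: 'a)"
    using Suc.hyps by (simp add: rcoef_def b u)
  \<comment> \<open>Differentiation is linear, so both arguments carry the same scalar.\<close>
  also have "subres_mat ?J (?J - 1) (smult ?R ?S) (pderiv (smult ?R ?S)) j = ?R \<cdot>\<^sub>m ?M"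
    by (simp only: pderiv_smult subres_mat_smult)
  also have "subres_poly (?R \<cdot>\<^sub>m ?M) j = smult (?R ^ bcoef js (Suc k) j) (subres_poly ?M j)"
  proof -
    have "dim_col ?M = bcoef js (Suc k) j" "dim_col ?M + j \<le> dim_row ?M"
      using j by (auto simp: subres_mat_def b)
    then show ?thesis by (simp only: subres_poly_smult)
  qed
  also have "subres_poly ?M j = nested_subres F G js (Suc k) j"
    by (simp add: l Let_def)
  finally show ?case by (simp add: mult.commute)
qed

section \<open>Degree bounds supplied by the recursive PRS\<close>

text \<open>Length at least three puts the last element strictly after the second one, so the strict
  descent of degrees applies at least once.\<close>

lemma is_prs_degree_last:
  assumes prs: "is_prs A B Ps" and len: "length Ps \<ge> 3"
  shows "degree (last Ps) < degree B"
proof -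
  have decr: "degree (Ps ! Suc i) < degree (Ps ! i)" if "Suc i < length Ps" for i
  proof -
    have "\<forall>i. 0 < i \<and> i < length Ps \<longrightarrow> degree (Ps ! i) < degree (Ps ! (i - 1))"
      using prs by (simp add: is_prs_def)
    from this[rule_format, of "Suc i"] that show ?thesis by simp
  qed
  have "degree (Ps ! Suc (Suc i)) < degree (Ps ! 1)" if "Suc (Suc i) < length Ps" for i
    using that
  proof (induction i)
    case 0
    then show ?case using decr[of 1] by simp
  next
    case (Suc i)
    then show ?case using decr[of "Suc (Suc i)"] by simp
  qed
  moreover obtain i where "length Ps = Suc (Suc (Suc i))"
    using that[of "length Ps - 3"] len by simp
  moreover have "Ps \<noteq> []" "Ps ! 1 = B" using prs len by (auto simp: is_prs_def)
  ultimately show ?thesis by (simp add: last_conv_nth)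
qed

theorem mainTheorem6:
  fixes F G :: "'a::field_char_0 poly" and Pss :: "'a poly list list"
  assumes "degree F > degree G" and "degree G > 0"
    and "complete_recursive_prs F G Pss"
    and "\<forall>k. k + 1 < length Pss \<longrightarrow> length (Pss ! k) \<ge> 3"
    and "1 \<le> k" and "k \<le> length Pss"
    and "j < degree (Pss ! (k - 1) ! 1)"
  shows "rec_subres F G (jseq F Pss) k j =
         smult (Rprime (jseq F Pss) (degree G) (k - 1) ^ bcoef (jseq F Pss) k j
                * rcoef (jseq F Pss) (degree G) k j)
               (nested_subres F G (jseq F Pss) k j)"
proof (rule rec_subres_eq)
  let ?js = "jseq F Pss"
  \<comment> \<open>The second element is \<open>G\<close> in the first PRS. In later ones it is the
    derivative of the previous last element, so its degree is at most
    \<open>?js (i - 1)\<close>.\<close>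
  have second: "\<exists>A. is_prs A (Pss ! (i - 1) ! 1) (Pss ! (i - 1)) \<and>
      degree (Pss ! (i - 1) ! 1) \<le> sbound ?js (degree G) i" if "1 \<le> i" "i \<le> length Pss" for i
  proof (cases "i = 1")
    case True
    have prs: "is_prs F G (Pss ! 0)" using assms(3) by (simp add: complete_recursive_prs_def)
    then have "Pss ! 0 ! 1 = G" by (simp add: is_prs_def)
    with prs True show ?thesis by (intro exI[of _ F]) (simp add: sbound_def)
  next
    case False
    let ?A = "last (Pss ! (i - 2))"
    have "\<forall>k. 0 < k \<and> k < length Pss \<longrightarrow>
        is_prs (last (Pss ! (k - 1))) (pderiv (last (Pss ! (k - 1)))) (Pss ! k)"
      using assms(3) by (simp add: complete_recursive_prs_def)
    from this[rule_format, of "i - 1"] that False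
    have prs: "is_prs ?A (pderiv ?A) (Pss ! (i - 1))" by (simp add: numeral_2_eq_2)
    then have "Pss ! (i - 1) ! 1 = pderiv ?A" by (simp add: is_prs_def)
    with prs that False show ?thesis
      by (intro exI[of _ ?A]) (simp add: sbound_def jseq_def degree_pderiv numeral_2_eq_2)
  qed
  show "j < sbound ?js (degree G) k" using second[of k] assms(5-7) by auto
  fix i assume i: "1 \<le> i" "i < k"
  \<comment> \<open>A PRS before the \<open>k\<close>-th is not the final one, so it has at least
    three elements.\<close>
  then have "i - 1 + 1 < length Pss" using assms(6) by simp
  then have len: "length (Pss ! (i - 1)) \<ge> 3" using assms(4) by blast
  have "i \<le> length Pss" using i assms(6) by simp
  with second[of i] i(1) obtain A where "is_prs A (Pss ! (i - 1) ! 1) (Pss ! (i - 1))"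
    and le: "degree (Pss ! (i - 1) ! 1) \<le> sbound ?js (degree G) i"
    by blast
  from is_prs_degree_last[OF this(1) len] le
  have "degree (last (Pss ! (i - 1))) < sbound ?js (degree G) i" by linarith
  with i show "?js i < sbound ?js (degree G) i" by (simp add: jseq_def)
qed (use assms in \<open>simp_all add: jseq_def\<close>)

end
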